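(* Let $\gamma>0$, $\gamma\neq1$ be constant. Then the set of (complex) ITEs is symmetric with respect to the real axis and contained in a strip $\{|\operatorname{Im}\lambda|\le C(\gamma)\}$ for some $C(\gamma)>0$, and, as $r\to\infty$, \[ N^{\rm alg}_{\mathbb{C}}(r)=(1+\gamma)\frac{r}{\pi}+o(r). \]
   Context: Half-line problem: for $\lambda\in\mathbb{C}\setminus\{0\}$, find $(u,v)$ on $[0,1]$ with $-u''-\lambda^2u=0$, $-v''-\lambda^2\gamma^2v=0$, $u(0)=v(0)=0$, $u(1)=v(1)$, $u'(1)=v'(1)$; $\lambda$ is an ITE if a nontrivial pair exists. ITEs are the nonzero zeros of the entire function $F(\lambda)=\gamma\sin\lambda\cos(\gamma\lambda)-\sin(\gamma\lambda)\cos\lambda$; the algebraic multiplicity of an ITE is its order as a zero of $F$. $N^{\rm alg}_{\mathbb{C}}(r)$ is the number of ITEs $\lambda$ with $\operatorname{Re}\lambda>0$ and $|\lambda|\le r$, counted with algebraic multiplicity. *)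

theory Defs
  imports "HOL-Analysis.Analysis" "HOL-Library.Landau_Symbols"
begin

definition ITE_F :: "real \<Rightarrow> complex \<Rightarrow> complex" where
  "ITE_F \<gamma> z = of_real \<gamma> * sin z * cos (of_real \<gamma> * z) - sin (of_real \<gamma> * z) * cos z"

definition is_ITE :: "real \<Rightarrow> complex \<Rightarrow> bool" where
  "is_ITE \<gamma> z \<longleftrightarrow> z \<noteq> 0 \<and> ITE_F \<gamma> z = 0"

definition alg_mult :: "real \<Rightarrow> complex \<Rightarrow> nat" where
  "alg_mult \<gamma> z = (LEAST n. (deriv ^^ n) (ITE_F \<gamma>) z \<noteq> 0)"

definition N_alg :: "real \<Rightarrow> real \<Rightarrow> real" where
  "N_alg \<gamma> r = real (\<Sum>z\<in>{z. is_ITE \<gamma> z \<and> Re z > 0 \<and> norm z \<le> r}. alg_mult \<gamma> z)"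

end

theory Submission
  imports Defs "HOL-Complex_Analysis.Complex_Analysis"
begin

text \<open>
  Write \<open>F(z) = A sin(a z) + B sin(b z)\<close> with \<open>A = (\<gamma> - 1)/2\<close>, \<open>B = (\<gamma> + 1)/2\<close>,
  \<open>a = 1 + \<gamma>\<close>, \<open>b = 1 - \<gamma>\<close>, so that \<open>|b| < a\<close>. Far from the real axis the first
  term dominates: \<open>F\<close> has no zeros there, and \<open>F'/F\<close> is uniformly close to \<open>-ia\<close> above and to
  \<open>ia\<close> below. Apply the argument principle to the rectangle \<open>[s\<^sub>0, s] \<times> [-C, C]\<close>. The
  horizontal sides contribute \<open>2ia(s - s\<^sub>0)\<close> up to an error \<open>\<epsilon> s\<close>. The vertical sides contribute
  \<open>O(1)\<close> if \<open>s\<close> is chosen suitably in a given unit interval: a real translate of \<open>F\<close> only changes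
  the phases of the two sines, the phases range over a compact torus, and for every pair of phases
  some vertical segment avoids the zeros; hence \<open>|F|\<close> is bounded below, uniformly, on some
  vertical segment over each unit interval.
\<close>

section \<open>Exponential bounds for complex sine and cosine\<close>

lemma norm_sin_le_exp_Im: "norm (sin (z::complex)) \<le> exp \<bar>Im z\<bar>"
proof -
  have "norm (exp (\<i> * z) - exp (- (\<i> * z))) \<le> norm (exp (\<i> * z)) + norm (exp (- (\<i> * z)))"
    by (rule norm_triangle_ineq4)
  also have "\<dots> = exp (- Im z) + exp (Im z)"
    by (simp add: norm_exp_eq_Re)
  also have "\<dots> \<le> 2 * exp \<bar>Im z\<bar>"
    using exp_le_cancel_iff[of "- Im z" "\<bar>Im z\<bar>"] exp_le_cancel_iff[of "Im z" "\<bar>Im z\<bar>"] by linarith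
  finally show ?thesis
    by (simp add: sin_exp_eq norm_divide norm_mult)
qed

lemma norm_cos_le_exp_Im: "norm (cos (z::complex)) \<le> exp \<bar>Im z\<bar>"
  using norm_sin_le_exp_Im[of "of_real pi / 2 - z"]
  by (simp add: cos_sin_eq flip: of_real_divide)

text \<open>Reverse triangle inequality in Euler's formula. The bound has content only for
  \<open>Im z > 0\<close>, where \<open>exp (- (\<i> * z))\<close> is the dominant
  exponential.\<close>

lemma norm_sin_ge_exp_Im: "norm (sin (z::complex)) \<ge> (exp (Im z) - exp (- Im z)) / 2"
proof -
  have "norm (exp (- (\<i> * z))) - norm (exp (\<i> * z)) \<le> norm (exp (- (\<i> * z)) - exp (\<i> * z))"
    by (rule norm_triangle_ineq2)
  then have "exp (Im z) - exp (- Im z) \<le> norm (exp (- (\<i> * z)) - exp (\<i> * z))"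
    by (simp add: norm_exp_eq_Re)
  then show ?thesis
    by (simp add: sin_exp_eq norm_divide norm_mult norm_minus_commute)
qed

section \<open>Multiplicities and the argument principle on rectangles\<close>

lemma zorder_eq_LEAST_deriv_nonzero:
  assumes "f holomorphic_on UNIV" and "f w \<noteq> 0"
  shows "zorder f z = int (LEAST n. (deriv ^^ n) f z \<noteq> 0)"
proof -
  \<comment> \<open>By the identity theorem, a function with all derivatives zero at
    \<open>z\<close> would vanish at \<open>w\<close> too. This makes the \<open>LEAST\<close> well
    defined.\<close>
  have ex: "\<exists>n. (deriv ^^ n) f z \<noteq> 0"
    using holomorphic_fun_eq_0_on_connected[OF assms(1), of z w] assms(2) by auto
  show ?thesis
  proof (rule zorder_zero_eqI[OF assms(1)])
    show "(deriv ^^ nat (int (LEAST n. (deriv ^^ n) f z \<noteq> 0))) f z \<noteq> 0"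
      using LeastI_ex[OF ex] by simp
    show "(deriv ^^ i) f z = 0" if "i < nat (int (LEAST n. (deriv ^^ n) f z \<noteq> 0))" for i
      using not_less_Least[of i "\<lambda>n. (deriv ^^ n) f z \<noteq> 0"] that by auto
  qed auto
qed

text \<open>The winding number of a rectangle is 1 inside and 0 outside, and no zero lies on the
  path, so the weighted sum of orders becomes a plain count with multiplicity.\<close>

lemma argument_principle_rectpath:
  fixes p q :: complex
  assumes f: "f holomorphic_on UNIV" "\<not> f constant_on UNIV"
    and pq: "Re p < Re q" "Im p < Im q"
    and nz: "\<And>z. z \<in> path_image (rectpath p q) \<Longrightarrow> f z \<noteq> 0"
  shows "contour_integral (rectpath p q) (\<lambda>z. deriv f z / f z) =
    2 * of_real pi * \<i> * of_nat (\<Sum>z | z \<in> box p q \<and> f z = 0. LEAST n. (deriv ^^ n) f z \<noteq> 0)"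
proof -
  \<comment> \<open>Enlarging the rectangle by 1 on each side gives an open connected set around the
    path. It is bounded, so it contains only finitely many zeros.\<close>
  define S where "S = box (p - Complex 1 1) (q + Complex 1 1)"
  define m where "m z = (LEAST n. (deriv ^^ n) f z \<noteq> 0)" for z
  obtain w where w: "f w \<noteq> 0"
    using nz[of p] pathstart_in_path_image[of "rectpath p q"] by auto
  have sub: "cbox p q \<subseteq> S"
    by (auto simp: S_def in_cbox_complex_iff in_box_complex_iff)
  have fin: "finite {z \<in> S. f z = 0}"
  proof (rule finite_subset)
    show "finite {z \<in> closure S. f z = 0}"
      using holomorphic_compact_finite_zeros[OF f(1) _ _ _ _ f(2), of "closure S"]
      by (auto simp: S_def bounded_box compact_closure)
    show "{z \<in> S. f z = 0} \<subseteq> {z \<in> closure S. f z = 0}"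
      using closure_subset by blast
  qed
  have img: "path_image (rectpath p q) \<subseteq> S"
    using path_image_rectpath_subset_cbox[of p q] pq sub by auto
  have out: "\<forall>z. z \<notin> S \<longrightarrow> winding_number (rectpath p q) z = 0"
    using winding_number_rectpath_outside[of p q] pq sub by (meson less_imp_le subsetD)
  have "contour_integral (rectpath p q) (\<lambda>z. deriv f z / f z) =
     2 * of_real pi * \<i> * (\<Sum>z | z \<in> S \<and> f z = 0. winding_number (rectpath p q) z * zorder f z)"
    using argument_principle[of S f "{}" "\<lambda>_. 1" "rectpath p q"] img nz fin out
      holomorphic_on_subset[OF f(1), of S]
    by (simp add: S_def open_box is_interval_connected subset_eq)
  \<comment> \<open>A zero in \<open>S\<close> but not in the open box cannot lie on the boundary,
    hence lies outside the closed box and has winding number 0.\<close>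
  also have "(\<Sum>z | z \<in> S \<and> f z = 0. winding_number (rectpath p q) z * zorder f z)
     = (\<Sum>z | z \<in> box p q \<and> f z = 0. of_nat (m z))"
  proof (rule sum.mono_neutral_cong_right[OF fin])
    show "{z. z \<in> box p q \<and> f z = 0} \<subseteq> {z \<in> S. f z = 0}"
      using sub box_subset_cbox[of p q] by blast
    show "\<forall>z\<in>{z \<in> S. f z = 0} - {z. z \<in> box p q \<and> f z = 0}.
       winding_number (rectpath p q) z * zorder f z = 0"
    proof
      fix z assume z: "z \<in> {z \<in> S. f z = 0} - {z. z \<in> box p q \<and> f z = 0}"
      have "z \<notin> cbox p q"
      proof
        assume "z \<in> cbox p q"
        with z have "z \<in> path_image (rectpath p q)"
          using path_image_rectpath_cbox_minus_box[of p q] pq by auto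
        with nz z show False by blast
      qed
      then show "winding_number (rectpath p q) z * zorder f z = 0"
        using pq winding_number_rectpath_outside[of p q z] by simp
    qed
    show "winding_number (rectpath p q) z * zorder f z = of_nat (m z)"
      if "z \<in> {z. z \<in> box p q \<and> f z = 0}" for z
      using that zorder_eq_LEAST_deriv_nonzero[OF f(1) w, of z]
      by (simp add: winding_number_rectpath m_def)
  qed
  finally show ?thesis
    by (simp only: m_def of_nat_sum)
qed

section \<open>Contour integrals of nearly constant functions\<close>

lemma contour_integral_linepath_near_const:
  assumes "continuous_on (closed_segment p q) \<phi>"
    and "\<And>z. z \<in> closed_segment p q \<Longrightarrow> norm (\<phi> z - c) \<le> M"
  shows "norm (contour_integral (linepath p q) \<phi> - c * (q - p)) \<le> M * norm (q - p)"
proof -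
  have "(\<phi> has_contour_integral contour_integral (linepath p q) \<phi>) (linepath p q)"
    by (intro has_contour_integral_integral contour_integrable_continuous_linepath assms)
  then have "((\<lambda>z. \<phi> z - c) has_contour_integral
      contour_integral (linepath p q) \<phi> - c * (q - p)) (linepath p q)"
    by (intro has_contour_integral_diff has_contour_integral_const_linepath)
  moreover have "M \<ge> 0"
    using order_trans[OF norm_ge_zero assms(2)[of p]] by simp
  ultimately show ?thesis
    using assms(2) by (rule has_contour_integral_bound_linepath)
qed

text \<open>The bottom side runs right with values near \<open>c\<close>, the top side runs left
  with values near \<open>- c\<close>, so the two contributions add up to
  \<open>2 * c * (x1 - x0)\<close>. Each vertical side has length \<open>2 * C\<close> and
  contributes at most \<open>2 * C * M\<close>.\<close>

lemma contour_integral_rectpath_estimate: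
  assumes C: "C > 0" and x: "x0 < x1"
    and cont: "continuous_on (path_image (rectpath (Complex x0 (- C)) (Complex x1 C))) \<phi>"
    and bot: "\<And>z. Im z = - C \<Longrightarrow> norm (\<phi> z - c) \<le> \<epsilon>"
    and top: "\<And>z. Im z = C \<Longrightarrow> norm (\<phi> z + c) \<le> \<epsilon>"
    and vert: "\<And>z. Re z = x0 \<or> Re z = x1 \<Longrightarrow> \<bar>Im z\<bar> \<le> C \<Longrightarrow> norm (\<phi> z) \<le> M"
  shows "norm (contour_integral (rectpath (Complex x0 (- C)) (Complex x1 C)) \<phi>
      - 2 * c * of_real (x1 - x0)) \<le> 2 * \<epsilon> * (x1 - x0) + 4 * C * M"
proof -
  define p1 p2 p3 p4 where p_def: "p1 = Complex x0 (- C)" "p2 = Complex x1 (- C)"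
    "p3 = Complex x1 C" "p4 = Complex x0 C"
  have rect: "rectpath p1 p3 =
      linepath p1 p2 +++ linepath p2 p3 +++ linepath p3 p4 +++ linepath p4 p1"
    by (simp add: rectpath_def Let_def p_def)
  have img: "path_image (rectpath p1 p3) = closed_segment p1 p2 \<union> closed_segment p2 p3
      \<union> closed_segment p3 p4 \<union> closed_segment p4 p1"
    by (simp add: rect path_image_join Un_assoc)
  have cs: "continuous_on (closed_segment p1 p2) \<phi>" "continuous_on (closed_segment p2 p3) \<phi>"
    "continuous_on (closed_segment p3 p4) \<phi>" "continuous_on (closed_segment p4 p1) \<phi>"
    using cont img unfolding p_def by (auto intro: continuous_on_subset)
  define I1 I2 I3 I4 where I_def: "I1 = contour_integral (linepath p1 p2) \<phi>"
    "I2 = contour_integral (linepath p2 p3) \<phi>" "I3 = contour_integral (linepath p3 p4) \<phi>"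
    "I4 = contour_integral (linepath p4 p1) \<phi>"
  have I: "contour_integral (rectpath p1 p3) \<phi> = I1 + (I2 + (I3 + I4))"
    unfolding rect I_def
    by (intro contour_integral_unique has_contour_integral_join has_contour_integral_integral
        contour_integrable_continuous_linepath cs) auto
  have d: "p2 - p1 = of_real (x1 - x0)" "p4 - p3 = - of_real (x1 - x0)"
    "p3 - p2 = 2 * C * \<i>" "p1 - p4 = - (2 * C * \<i>)"
    by (auto simp: p_def complex_eq_iff)
  have seg: "z \<in> closed_segment p1 p2 \<Longrightarrow> Im z = - C" "z \<in> closed_segment p3 p4 \<Longrightarrow> Im z = C"
    "z \<in> closed_segment p2 p3 \<Longrightarrow> Re z = x1 \<and> \<bar>Im z\<bar> \<le> C"
    "z \<in> closed_segment p4 p1 \<Longrightarrow> Re z = x0 \<and> \<bar>Im z\<bar> \<le> C" for z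
    using C by (auto simp: p_def closed_segment_same_Re closed_segment_same_Im closed_segment_eq_real_ivl split: if_splits)
  have "norm (I1 - c * (p2 - p1)) \<le> \<epsilon> * norm (p2 - p1)"
    unfolding I_def using cs bot seg by (intro contour_integral_linepath_near_const) auto
  moreover have "norm (I3 - (- c) * (p4 - p3)) \<le> \<epsilon> * norm (p4 - p3)"
    unfolding I_def using cs top seg by (intro contour_integral_linepath_near_const) auto
  moreover have "norm (I2 - 0 * (p3 - p2)) \<le> M * norm (p3 - p2)"
    unfolding I_def using cs vert seg by (intro contour_integral_linepath_near_const) auto
  moreover have "norm (I4 - 0 * (p1 - p4)) \<le> M * norm (p1 - p4)"
    unfolding I_def using cs vert seg by (intro contour_integral_linepath_near_const) auto
  moreover have "norm (p2 - p1) = x1 - x0" "norm (p4 - p3) = x1 - x0"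
    "norm (p3 - p2) = 2 * C" "norm (p1 - p4) = 2 * C"
    unfolding d using C x by (auto simp only: norm_of_real norm_minus_cancel norm_mult) auto
  ultimately have
    bounds: "norm (I1 - c * (p2 - p1)) \<le> \<epsilon> * (x1 - x0)" "norm (I3 - (- c) * (p4 - p3)) \<le> \<epsilon> * (x1 - x0)"
      "norm I2 \<le> M * (2 * C)" "norm I4 \<le> M * (2 * C)"
    by simp_all
  have "I1 + (I2 + (I3 + I4)) - 2 * c * of_real (x1 - x0)
      = I1 - c * (p2 - p1) + (I3 - (- c) * (p4 - p3)) + I2 + I4"
    unfolding d by (simp add: algebra_simps)
  also have "norm \<dots> \<le> \<epsilon> * (x1 - x0) + \<epsilon> * (x1 - x0) + M * (2 * C) + M * (2 * C)"
    by (intro norm_triangle_mono bounds)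
  finally have "norm (contour_integral (rectpath p1 p3) \<phi> - 2 * c * of_real (x1 - x0))
      \<le> \<epsilon> * (x1 - x0) + \<epsilon> * (x1 - x0) + M * (2 * C) + M * (2 * C)"
    unfolding I .
  then show ?thesis
    by (simp add: p_def algebra_simps)
qed

section \<open>Sums of two sines and their logarithmic derivative\<close>

locale sine_pair =
  fixes A B a b :: real
  assumes A_nonzero: "A \<noteq> 0" and b_less_a: "\<bar>b\<bar> < a"
begin

text \<open>The phases are parameters because real translations act on them alone; the function
  whose zeros are counted is \<open>G 0 0\<close>.\<close>

definition G :: "real \<Rightarrow> real \<Rightarrow> complex \<Rightarrow> complex" where
  "G \<alpha> \<beta> z = of_real A * sin (of_real a * z + of_real \<alpha>) + of_real B * sin (of_real b * z + of_real \<beta>)"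

definition G' :: "real \<Rightarrow> real \<Rightarrow> complex \<Rightarrow> complex" where
  "G' \<alpha> \<beta> z = of_real (A * a) * cos (of_real a * z + of_real \<alpha>) + of_real (B * b) * cos (of_real b * z + of_real \<beta>)"

lemma a_pos: "a > 0"
  using b_less_a by linarith

lemma has_field_derivative_G: "(G \<alpha> \<beta> has_field_derivative G' \<alpha> \<beta> z) (at z)"
  unfolding G_def[abs_def] G'_def by (auto intro!: derivative_eq_intros simp: algebra_simps)

lemma deriv_G: "deriv (G \<alpha> \<beta>) = G' \<alpha> \<beta>"
  using has_field_derivative_G DERIV_imp_deriv by blast

lemma holomorphic_G: "G \<alpha> \<beta> holomorphic_on S"
  using has_field_derivative_G by (meson holomorphic_onI field_differentiable_at_within field_differentiable_def)

lemma continuous_on_G: "continuous_on S (G \<alpha> \<beta>)"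
  unfolding G_def[abs_def] by (intro continuous_intros)

lemma continuous_on_G': "continuous_on S (G' \<alpha> \<beta>)"
  unfolding G'_def[abs_def] by (intro continuous_intros)

text \<open>In \<open>G' + \<i> * a * G\<close> the leading sine and cosine combine to an
  exponential that decays upwards, leaving growth of order
  \<open>exp (\<bar>b\<bar> * Im z)\<close>, whereas \<open>G\<close> grows like
  \<open>exp (a * Im z)\<close>. All bounds depend on \<open>Im z\<close> alone, so one
  \<open>Y\<close> serves all phases and real parts.\<close>

lemma log_deriv_G_upper:
  assumes "\<epsilon> > 0"
  obtains Y where "Y > 0"
    "\<And>\<alpha> \<beta> z. Im z \<ge> Y \<Longrightarrow> G \<alpha> \<beta> z \<noteq> 0 \<and> norm (G' \<alpha> \<beta> z / G \<alpha> \<beta> z + \<i> * a) \<le> \<epsilon>"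
proof -
  \<comment> \<open>At height \<open>y\<close>, \<open>L y\<close> will bound \<open>norm G\<close>
    from below and \<open>E y\<close> will bound \<open>norm (G' + \<i> * a * G)\<close> from
    above.\<close>
  define L where "L y = \<bar>A\<bar> * ((exp (a * y) - exp (- (a * y))) / 2) - \<bar>B\<bar> * exp (\<bar>b\<bar> * y)" for y
  define E where "E y = \<bar>A\<bar> * a * exp (- (a * y)) + \<bar>B\<bar> * (\<bar>b\<bar> + a) * exp (\<bar>b\<bar> * y)" for y
  have neg_exp: "((\<lambda>y. exp (- (k * y))) \<longlongrightarrow> 0) at_top" if "k > 0" for k :: real
    using that by real_asymp
  have sc1: "exp (- (a * y)) * exp (\<bar>b\<bar> * y) = exp (- ((a - \<bar>b\<bar>) * y))"
    "exp (- (a * y)) * exp (- (a * y)) = exp (- (2 * a * y))"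
    "exp (- (a * y)) * exp (a * y) = 1" for y
    by (simp_all add: algebra_simps flip: exp_add)
  \<comment> \<open>After scaling by \<open>exp (- (a * y))\<close>, \<open>L\<close> tends to
    \<open>\<bar>A\<bar> / 2 > 0\<close> and \<open>E\<close> to 0, so eventually
    \<open>E y \<le> \<epsilon> * L y\<close>.\<close>
  have Lsc: "exp (- (a * y)) * L y = \<bar>A\<bar> * ((1 - exp (- (2 * a * y))) / 2) - \<bar>B\<bar> * exp (- ((a - \<bar>b\<bar>) * y))" for y
    unfolding L_def sc1[symmetric] by (simp add: algebra_simps flip: exp_add)
  have Esc: "exp (- (a * y)) * E y = \<bar>A\<bar> * a * exp (- (2 * a * y)) + \<bar>B\<bar> * (\<bar>b\<bar> + a) * exp (- ((a - \<bar>b\<bar>) * y))" for y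
    unfolding E_def sc1[symmetric] by (simp add: algebra_simps flip: exp_add)
  have Llim: "((\<lambda>y. exp (- (a * y)) * L y) \<longlongrightarrow> \<bar>A\<bar> * ((1 - 0) / 2) - \<bar>B\<bar> * 0) at_top"
    unfolding Lsc using a_pos b_less_a by (intro tendsto_intros neg_exp) auto
  have Elim: "((\<lambda>y. exp (- (a * y)) * E y) \<longlongrightarrow> \<bar>A\<bar> * a * 0 + \<bar>B\<bar> * (\<bar>b\<bar> + a) * 0) at_top"
    unfolding Esc using a_pos b_less_a by (intro tendsto_intros neg_exp) auto
  have "((\<lambda>y. \<epsilon> * (exp (- (a * y)) * L y) - exp (- (a * y)) * E y) \<longlongrightarrow>
      \<epsilon> * (\<bar>A\<bar> * ((1 - 0) / 2) - \<bar>B\<bar> * 0) - (\<bar>A\<bar> * a * 0 + \<bar>B\<bar> * (\<bar>b\<bar> + a) * 0)) at_top"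
    by (intro tendsto_intros Llim Elim)
  then have "eventually (\<lambda>y. \<epsilon> * (exp (- (a * y)) * L y) - exp (- (a * y)) * E y > 0) at_top"
    by (rule order_tendstoD) (use assms A_nonzero in auto)
  moreover have "eventually (\<lambda>y. exp (- (a * y)) * L y > 0) at_top"
    by (rule order_tendstoD[OF Llim]) (use A_nonzero in auto)
  ultimately have "eventually (\<lambda>y. L y > 0 \<and> E y \<le> \<epsilon> * L y) at_top"
  proof eventually_elim
    case (elim y)
    have "exp (- (a * y)) * (\<epsilon> * L y - E y) > 0"
      using elim(1) by (simp add: algebra_simps)
    then have "\<epsilon> * L y - E y > 0"
      by (simp add: zero_less_mult_iff)
    with elim(2) show ?case
      by (auto simp add: zero_less_mult_iff)
  qed
  then obtain Y0 where Y0: "\<And>y. y \<ge> Y0 \<Longrightarrow> L y > 0 \<and> E y \<le> \<epsilon> * L y"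
    by (auto simp: eventually_at_top_linorder)
  show ?thesis
  \<comment> \<open>The 1 keeps \<open>Im z\<close> positive, so that
    \<open>\<bar>Im z\<bar>\<close> can be replaced by \<open>Im z\<close> in the exponents.\<close>
  proof (rule that[of "max Y0 1"])
    fix \<alpha> \<beta> z assume z: "Im z \<ge> max Y0 1"
    define s c s' c' where sc: "s = sin (of_real a * z + of_real \<alpha>)" "c = cos (of_real a * z + of_real \<alpha>)"
      "s' = sin (of_real b * z + of_real \<beta>)" "c' = cos (of_real b * z + of_real \<beta>)"
    have s: "norm s \<ge> (exp (a * Im z) - exp (- (a * Im z))) / 2"
      using norm_sin_ge_exp_Im[of "of_real a * z + of_real \<alpha>"] by (simp add: sc)
    have s': "norm s' \<le> exp (\<bar>b\<bar> * Im z)" and c': "norm c' \<le> exp (\<bar>b\<bar> * Im z)"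
      using norm_sin_le_exp_Im[of "of_real b * z + of_real \<beta>"]
        norm_cos_le_exp_Im[of "of_real b * z + of_real \<beta>"] z by (auto simp: sc abs_mult)
    have cis: "norm (c + \<i> * s) = exp (- (a * Im z))"
      unfolding sc
      by (simp flip: exp_Euler add: norm_exp_eq_Re)
    have "L (Im z) \<le> \<bar>A\<bar> * norm s - \<bar>B\<bar> * norm s'"
      unfolding L_def by (intro diff_mono mult_left_mono s s') auto
    also have "\<dots> \<le> norm (G \<alpha> \<beta> z)"
      unfolding G_def sc[symmetric]
      using norm_triangle_ineq2[of "of_real A * s" "- (of_real B * s')"] by (simp add: norm_mult)
    finally have G: "L (Im z) \<le> norm (G \<alpha> \<beta> z)" .
    have "G' \<alpha> \<beta> z + \<i> * a * G \<alpha> \<beta> z = of_real (A * a) * (c + \<i> * s) + of_real B * (of_real b * c' + \<i> * a * s')"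
      unfolding G_def G'_def sc[symmetric] by (simp add: algebra_simps)
    also have "norm \<dots> \<le> \<bar>A\<bar> * a * norm (c + \<i> * s) + \<bar>B\<bar> * (\<bar>b\<bar> * norm c' + a * norm s')"
      using a_pos norm_triangle_ineq[of "of_real b * c'" "\<i> * a * s'"]
      by (intro norm_triangle_mono) (auto simp: norm_mult abs_mult intro!: mult_left_mono)
    also have "\<dots> \<le> \<bar>A\<bar> * a * exp (- (a * Im z)) + \<bar>B\<bar> * (\<bar>b\<bar> * exp (\<bar>b\<bar> * Im z) + a * exp (\<bar>b\<bar> * Im z))"
      unfolding cis using a_pos by (intro add_left_mono mult_left_mono add_mono s' c') auto
    also have "\<dots> = E (Im z)"
      by (simp add: E_def algebra_simps)
    also have "\<dots> \<le> \<epsilon> * norm (G \<alpha> \<beta> z)"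
      using Y0[of "Im z"] z G assms by (meson max.boundedE mult_left_mono order.strict_implies_order order_trans)
    finally have E: "norm (G' \<alpha> \<beta> z + \<i> * a * G \<alpha> \<beta> z) \<le> \<epsilon> * norm (G \<alpha> \<beta> z)" .
    have nz: "G \<alpha> \<beta> z \<noteq> 0"
      using Y0[of "Im z"] z G by auto
    then have "G' \<alpha> \<beta> z / G \<alpha> \<beta> z + \<i> * a = (G' \<alpha> \<beta> z + \<i> * a * G \<alpha> \<beta> z) / G \<alpha> \<beta> z"
      by (simp add: field_simps)
    with E nz show "G \<alpha> \<beta> z \<noteq> 0 \<and> norm (G' \<alpha> \<beta> z / G \<alpha> \<beta> z + \<i> * a) \<le> \<epsilon>"
      by (simp add: norm_divide field_simps)
  qed auto
qed

text \<open>A constant \<open>G\<close> would make \<open>G' / G\<close> zero, at distance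
  \<open>a\<close> from \<open>- \<i> * a\<close>, although high up that distance is at most
  \<open>a / 2\<close>.\<close>

lemma G_not_constant: "\<not> G \<alpha> \<beta> constant_on UNIV"
proof
  assume "G \<alpha> \<beta> constant_on UNIV"
  then obtain k where k: "G \<alpha> \<beta> = (\<lambda>_. k)"
    by (auto simp: constant_on_def)
  have "G' \<alpha> \<beta> z = 0" for z
    using has_field_derivative_G[of \<alpha> \<beta> z] unfolding k by (metis DERIV_const DERIV_unique)
  moreover obtain Y where "\<And>\<alpha> \<beta> z. Im z \<ge> Y \<Longrightarrow> norm (G' \<alpha> \<beta> z / G \<alpha> \<beta> z + \<i> * a) \<le> a / 2"
    using log_deriv_G_upper[of "a / 2"] a_pos by (metis half_gt_zero)
  from this[of "\<i> * of_real Y" \<alpha> \<beta>] have "norm (G' \<alpha> \<beta> (\<i> * of_real Y) / G \<alpha> \<beta> (\<i> * of_real Y) + \<i> * a) \<le> a / 2"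
    by simp
  ultimately show False
    using a_pos by (simp add: norm_mult)
qed

section \<open>Zeros in bounded sets and vertical segments avoiding them\<close>

lemma finite_zeros_G:
  assumes "bounded S"
  shows "finite {z \<in> S. G \<alpha> \<beta> z = 0}"
proof (rule finite_subset)
  show "finite {z \<in> closure S. G \<alpha> \<beta> z = 0}"
    using holomorphic_compact_finite_zeros[OF holomorphic_G _ _ _ _ G_not_constant, of "closure S"] assms
    by auto
  show "{z \<in> S. G \<alpha> \<beta> z = 0} \<subseteq> {z \<in> closure S. G \<alpha> \<beta> z = 0}"
    using closure_subset by blast
qed

text \<open>The integers \<open>m\<close> and \<open>n\<close> are free, so the translated phases
  can be reduced to a compact interval.\<close>

lemma G_shift: "G 0 0 (of_real t + z) = G (a * t - 2 * pi * of_int m) (b * t - 2 * pi * of_int n) z"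
proof -
  have *: "sin (w - of_real (2 * pi * of_int k)) = sin w" for w :: complex and k :: int
  proof -
    have "sin (of_real (2 * pi * of_int k) :: complex) = 0" "cos (of_real (2 * pi * of_int k) :: complex) = 1"
      using sin_int_2pin[of k] cos_int_2pin[of k] unfolding sin_of_real cos_of_real by simp_all
    then show ?thesis by (simp only: sin_diff) simp
  qed
  have "sin (of_real a * (of_real t + z)) = sin (of_real a * z + of_real (a * t - 2 * pi * of_int m))"
    using *[of "of_real a * (of_real t + z)" m] by (simp add: algebra_simps)
  moreover have "sin (of_real b * (of_real t + z)) = sin (of_real b * z + of_real (b * t - 2 * pi * of_int n))"
    using *[of "of_real b * (of_real t + z)" n] by (simp add: algebra_simps)
  ultimately show ?thesis
    by (simp add: G_def)
qed

text \<open>The zeros in the rectangle have only finitely many real parts, while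
  \<open>{0<..1}\<close> is infinite.\<close>

lemma zero_free_vertical_line: "\<exists>s\<in>{0<..1}. \<forall>y\<in>{-C..C}. G \<alpha> \<beta> (Complex s y) \<noteq> 0"
proof -
  have "bounded (cbox (Complex 0 (-C)) (Complex 1 C))"
    by (rule bounded_cbox)
  then have "finite (Re ` {z \<in> cbox (Complex 0 (-C)) (Complex 1 C). G \<alpha> \<beta> z = 0})"
    by (intro finite_imageI finite_zeros_G)
  then have "\<not> {0<..1} \<subseteq> Re ` {z \<in> cbox (Complex 0 (-C)) (Complex 1 C). G \<alpha> \<beta> z = 0}"
    using infinite_Ioc[of "0::real" 1] finite_subset zero_less_one by blast
  then obtain s where s: "s \<in> {0<..1}" "s \<notin> Re ` {z \<in> cbox (Complex 0 (-C)) (Complex 1 C). G \<alpha> \<beta> z = 0}"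
    by blast
  have "G \<alpha> \<beta> (Complex s y) \<noteq> 0" if "y \<in> {-C..C}" for y
  proof
    assume "G \<alpha> \<beta> (Complex s y) = 0"
    with s(1) that have "Complex s y \<in> {z \<in> cbox (Complex 0 (-C)) (Complex 1 C). G \<alpha> \<beta> z = 0}"
      by (simp add: in_cbox_complex_iff)
    with s(2) show False
      by (metis complex.sel(1) imageI)
  qed
  with s(1) show ?thesis by blast
qed

text \<open>If no \<delta> worked, some translations \<open>t n\<close> would make
  \<open>G 0 0\<close> small somewhere on every vertical segment over the n-th unit interval. In the
  limit of the reduced phases this puts a zero on a segment chosen to be zero-free.\<close>

lemma vertical_line_lower_bound:
  obtains \<delta> where "\<delta> > 0"
    "\<And>t. \<exists>s\<in>{t<..t+1}. \<forall>y\<in>{-C..C}. norm (G 0 0 (Complex s y)) \<ge> \<delta>"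
proof (rule ccontr)
  assume "\<not> thesis"
  with that have "\<forall>\<delta>>0. \<exists>t. \<forall>s\<in>{t<..t+1}. \<exists>y\<in>{-C..C}. norm (G 0 0 (Complex s y)) < \<delta>"
    by (meson not_le)
  then have "\<forall>n. \<exists>t. \<forall>s\<in>{t<..t+1}. \<exists>y\<in>{-C..C}. norm (G 0 0 (Complex s y)) < inverse (real (Suc n))"
    by (metis inverse_positive_iff_positive of_nat_0_less_iff zero_less_Suc)
  then obtain t where t: "\<And>n. \<forall>s\<in>{t n<..t n+1}. \<exists>y\<in>{-C..C}. norm (G 0 0 (Complex s y)) < inverse (real (Suc n))"
    by metis
  \<comment> \<open>Reduction modulo \<open>2 * pi\<close>; the pairs of reduced phases lie in a
    compact square.\<close>
  define red where "red x = x - 2 * pi * of_int \<lfloor>x / (2 * pi)\<rfloor>" for x :: real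
  have red: "red x \<in> {0..2*pi}" for x
    using floor_divide_lower[of "2 * pi" x] floor_divide_upper[of "2 * pi" x]
    by (auto simp: red_def algebra_simps)
  have "compact ({0..2*pi} \<times> {0..2*pi::real})"
    by (intro compact_Times compact_Icc)
  moreover have "\<forall>n. (red (a * t n), red (b * t n)) \<in> {0..2*pi} \<times> {0..2*pi}"
    using red by auto
  ultimately obtain \<alpha>\<beta> r where r: "strict_mono r"
    "((\<lambda>n. (red (a * t n), red (b * t n))) \<circ> r) \<longlonglongrightarrow> \<alpha>\<beta>"
    unfolding compact_def by meson
  define \<alpha> \<beta> where "\<alpha> = fst \<alpha>\<beta>" and "\<beta> = snd \<alpha>\<beta>"
  \<comment> \<open>The offset \<open>s\<close> is chosen for the limit phases and then used for
    every \<open>n\<close>, as \<open>t n + s\<close> lies in the n-th interval.\<close>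
  obtain s where s: "s \<in> {0<..1}" "\<forall>y\<in>{-C..C}. G \<alpha> \<beta> (Complex s y) \<noteq> 0"
    using zero_free_vertical_line by blast
  have "\<forall>n. \<exists>y\<in>{-C..C}. norm (G 0 0 (Complex (t n + s) y)) < inverse (real (Suc n))"
    using t s(1) by simp
  then obtain y where y: "\<And>n. y n \<in> {-C..C}"
    "\<And>n. norm (G 0 0 (Complex (t n + s) (y n))) < inverse (real (Suc n))"
    by metis
  \<comment> \<open>A second subsequence makes the heights of the small values converge as
    well.\<close>
  have "\<forall>n. (y \<circ> r) n \<in> {-C..C}" using y by simp
  then obtain y0 r' where r': "y0 \<in> {-C..C}" "strict_mono r'" "((y \<circ> r) \<circ> r') \<longlonglongrightarrow> y0"
    using compact_Icc[of "-C" C] unfolding compact_def by meson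
  have lim: "(\<lambda>n. red (a * t (r (r' n)))) \<longlonglongrightarrow> \<alpha>" "(\<lambda>n. red (b * t (r (r' n)))) \<longlonglongrightarrow> \<beta>"
    using tendsto_fst[OF LIMSEQ_subseq_LIMSEQ[OF r(2) r'(2)]]
      tendsto_snd[OF LIMSEQ_subseq_LIMSEQ[OF r(2) r'(2)]] by (simp_all add: o_def \<alpha>_def \<beta>_def)
  \<comment> \<open>\<open>G\<close> is jointly continuous in the phases and the point; by
    \<open>G_shift\<close> these values are the small ones, so the limit is 0.\<close>
  have "(\<lambda>n. G (red (a * t (r (r' n)))) (red (b * t (r (r' n)))) (Complex s (y (r (r' n)))))
      \<longlonglongrightarrow> G \<alpha> \<beta> (Complex s y0)"
    unfolding G_def using r'(3) lim by (intro tendsto_intros) (auto simp: o_def)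
  moreover have "G (red (a * t n)) (red (b * t n)) (Complex s (y n)) = G 0 0 (Complex (t n + s) (y n))" for n
    using G_shift[of "t n" "Complex s (y n)" "\<lfloor>a * t n / (2 * pi)\<rfloor>" "\<lfloor>b * t n / (2 * pi)\<rfloor>"]
    by (simp add: red_def complex_of_real_def complex_add)
  ultimately have "(\<lambda>n. G 0 0 (Complex (t (r (r' n)) + s) (y (r (r' n))))) \<longlonglongrightarrow> G \<alpha> \<beta> (Complex s y0)"
    by simp
  moreover have "(\<lambda>n. G 0 0 (Complex (t (r (r' n)) + s) (y (r (r' n))))) \<longlonglongrightarrow> 0"
  proof (rule Lim_null_comparison)
    show "\<forall>\<^sub>F n in sequentially. norm (G 0 0 (Complex (t (r (r' n)) + s) (y (r (r' n))))) \<le> inverse (real (Suc (r (r' n))))"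
      using y(2) by (intro always_eventually allI less_imp_le)
    have "strict_mono (r \<circ> r')" using r r' by (simp add: strict_mono_o)
    then show "(\<lambda>n. inverse (real (Suc (r (r' n))))) \<longlonglongrightarrow> 0"
      using LIMSEQ_subseq_LIMSEQ[OF LIMSEQ_inverse_real_of_nat] by (fastforce simp: o_def)
  qed
  ultimately have "G \<alpha> \<beta> (Complex s y0) = 0"
    by (rule LIMSEQ_unique)
  with s r' show False by blast
qed

lemma norm_G'_le:
  assumes "\<bar>Im z\<bar> \<le> C"
  shows "norm (G' \<alpha> \<beta> z) \<le> \<bar>A * a\<bar> * exp (a * C) + \<bar>B * b\<bar> * exp (\<bar>b\<bar> * C)"
proof -
  have "norm (cos (of_real a * z + of_real \<alpha>)) \<le> exp (a * C)"
    using norm_cos_le_exp_Im[of "of_real a * z + of_real \<alpha>"] a_pos assms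
    by (auto simp: abs_mult intro: order_trans)
  moreover have "norm (cos (of_real b * z + of_real \<beta>)) \<le> exp (\<bar>b\<bar> * C)"
    using norm_cos_le_exp_Im[of "of_real b * z + of_real \<beta>"] mult_left_mono[OF assms, of "\<bar>b\<bar>"]
    by (auto simp: abs_mult intro: order_trans)
  ultimately show ?thesis
    unfolding G'_def by (intro norm_triangle_mono) (auto simp: norm_mult abs_mult intro!: mult_left_mono)
qed

section \<open>Counting the zeros of \<open>G 0 0\<close>\<close>

lemma G_odd: "G 0 0 (- z) = - G 0 0 z" and G'_even: "G' 0 0 (- z) = G' 0 0 z"
  by (simp_all add: G_def G'_def)

text \<open>The multiplicity has the form of \<open>alg_mult\<close>, so that \<open>N_alg\<close>
  unfolds to it. A sum over an infinite set is 0 by default, hence the boundedness assumptions in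
  the rules below.\<close>

definition count :: "complex set \<Rightarrow> real" where
  "count S = real (\<Sum>z | z \<in> S \<and> G 0 0 z = 0. LEAST n. (deriv ^^ n) (G 0 0) z \<noteq> 0)"

lemma count_nonneg: "count S \<ge> 0"
  by (simp add: count_def sum_nonneg)

lemma count_mono:
  assumes "bounded T" "\<And>z. z \<in> S \<Longrightarrow> G 0 0 z = 0 \<Longrightarrow> z \<in> T"
  shows "count S \<le> count T"
  unfolding count_def of_nat_le_iff using finite_zeros_G[OF assms(1), of 0 0] assms(2)
  by (intro sum_mono2) auto

lemma count_Un_le:
  assumes "bounded S" "bounded T"
  shows "count (S \<union> T) \<le> count S + count T"
proof -
  have eq: "{z. z \<in> S \<union> T \<and> G 0 0 z = 0} = {z. z \<in> S \<and> G 0 0 z = 0} \<union> {z. z \<in> T \<and> G 0 0 z = 0}"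
    by auto
  show ?thesis
    unfolding count_def eq
    using sum.union_inter[OF finite_zeros_G[OF assms(1), of 0 0] finite_zeros_G[OF assms(2), of 0 0],
        of "\<lambda>z. LEAST n. (deriv ^^ n) (G 0 0) z \<noteq> 0"]
    by (simp flip: of_nat_add del: of_nat_sum)
qed

lemma zeros_in_strip:
  obtains C where "C > 0" "\<And>z. G 0 0 z = 0 \<Longrightarrow> \<bar>Im z\<bar> \<le> C"
proof -
  obtain Y where Y: "Y > 0" "\<And>z. Im z \<ge> Y \<Longrightarrow> G 0 0 z \<noteq> 0"
    using log_deriv_G_upper[of 1] by (metis zero_less_one)
  have "\<bar>Im z\<bar> \<le> Y" if "G 0 0 z = 0" for z
    using Y(2)[of z] Y(2)[of "- z"] that by (force simp: G_odd)
  with Y(1) that show ?thesis by blast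
qed

text \<open>The argument principle equates the integral of \<open>G' / G\<close> with
  \<open>2 * pi * \<i>\<close> times the count; the side estimates with \<open>c = \<i> * a\<close>
  and vertical bound \<open>K / \<delta>\<close> are then divided by 2.\<close>

lemma count_rectangle:
  assumes C: "C > 0" and s: "s0 < s" and \<delta>: "\<delta> > 0"
    and top: "\<And>z. Im z = C \<Longrightarrow> G 0 0 z \<noteq> 0 \<and> norm (G' 0 0 z / G 0 0 z + \<i> * a) \<le> \<epsilon>"
    and vert: "\<And>x y. x \<in> {s0, s} \<Longrightarrow> y \<in> {-C..C} \<Longrightarrow> norm (G 0 0 (Complex x y)) \<ge> \<delta>"
    and K: "\<And>z. \<bar>Im z\<bar> \<le> C \<Longrightarrow> norm (G' 0 0 z) \<le> K"
  shows "\<bar>pi * count (box (Complex s0 (-C)) (Complex s C)) - a * (s - s0)\<bar>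
    \<le> \<epsilon> * (s - s0) + 2 * C * (K / \<delta>)"
proof -
  define p q where pq: "p = Complex s0 (-C)" "q = Complex s C"
  \<comment> \<open>The logarithmic derivative of an odd function is odd, so
    \<open>z \<mapsto> - z\<close> carries the top estimate to the bottom with opposite
    sign.\<close>
  have bot: "G 0 0 z \<noteq> 0 \<and> norm (G' 0 0 z / G 0 0 z - \<i> * a) \<le> \<epsilon>" if "Im z = - C" for z
    using top[of "- z"] that norm_minus_commute[of "G' 0 0 z / G 0 0 z" "\<i> * a"]
    by (simp add: G_odd G'_even)
  have vert': "norm (G 0 0 z) \<ge> \<delta>" if "Re z = s0 \<or> Re z = s" "\<bar>Im z\<bar> \<le> C" for z
    using vert[of "Re z" "Im z"] that by (auto simp: abs_le_iff)
  have K0: "K \<ge> 0"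
    using order_trans[OF norm_ge_zero K[of 0]] C by simp
  have img: "path_image (rectpath p q) = {z. Re z \<in> {s0, s} \<and> Im z \<in> {-C..C}} \<union>
      {z. Im z \<in> {-C, C} \<and> Re z \<in> {s0..s}}"
    using path_image_rectpath[of p q] C s by (simp add: pq)
  have nz: "G 0 0 z \<noteq> 0" if "z \<in> path_image (rectpath p q)" for z
    using that unfolding img using top bot vert'[of z] \<delta> by (auto simp: abs_le_iff)
  have "contour_integral (rectpath p q) (\<lambda>z. deriv (G 0 0) z / G 0 0 z) =
      2 * of_real pi * \<i> * of_nat (\<Sum>z | z \<in> box p q \<and> G 0 0 z = 0. LEAST n. (deriv ^^ n) (G 0 0) z \<noteq> 0)"
    by (rule argument_principle_rectpath[OF holomorphic_G G_not_constant])
      (use C s nz in \<open>auto simp: pq\<close>)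
  then have int: "contour_integral (rectpath p q) (\<lambda>z. G' 0 0 z / G 0 0 z) =
      2 * of_real pi * \<i> * of_real (count (box p q))"
    by (simp add: deriv_G count_def)
  have cont: "continuous_on (path_image (rectpath p q)) (\<lambda>z. G' 0 0 z / G 0 0 z)"
    using nz by (intro continuous_on_divide continuous_on_G continuous_on_G') auto
  have "norm (contour_integral (rectpath p q) (\<lambda>z. G' 0 0 z / G 0 0 z) - 2 * (\<i> * a) * of_real (s - s0))
      \<le> 2 * \<epsilon> * (s - s0) + 4 * C * (K / \<delta>)"
    unfolding pq
  proof (rule contour_integral_rectpath_estimate[OF C s])
    show "norm (G' 0 0 z / G 0 0 z) \<le> K / \<delta>" if "Re z = s0 \<or> Re z = s" "\<bar>Im z\<bar> \<le> C" for z
      unfolding norm_divide using vert'[of z] K[of z] that \<delta> K0 by (intro frac_le) auto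
  qed (use top bot cont in \<open>auto simp: pq\<close>)
  also have "contour_integral (rectpath p q) (\<lambda>z. G' 0 0 z / G 0 0 z) - 2 * (\<i> * a) * of_real (s - s0)
      = 2 * \<i> * of_real (pi * count (box p q) - a * (s - s0))"
    unfolding int by (simp add: algebra_simps)
  also have "norm \<dots> = 2 * \<bar>pi * count (box p q) - a * (s - s0)\<bar>"
    by (simp only: norm_mult norm_of_real) simp
  finally show ?thesis
    by (simp add: pq)
qed

text \<open>All zeros lie in the strip of half-width \<open>C\<close>, so the half disc is compared
  with rectangles ending just beyond \<open>r\<close> and just before \<open>r - C\<close>.\<close>

lemma count_half_disc:
  assumes \<epsilon>: "\<epsilon> > 0"
  obtains K where "\<forall>\<^sub>F r in at_top. \<bar>pi * count {z. Re z > 0 \<and> norm z \<le> r} - a * r\<bar> \<le> \<epsilon> * r + K"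
proof -
  obtain C where C: "C > 0"
    and up: "\<And>\<alpha> \<beta> z. Im z \<ge> C \<Longrightarrow> G \<alpha> \<beta> z \<noteq> 0 \<and> norm (G' \<alpha> \<beta> z / G \<alpha> \<beta> z + \<i> * a) \<le> \<epsilon>"
    using log_deriv_G_upper[OF \<epsilon>] by blast
  have strip: "\<bar>Im z\<bar> < C" if "G 0 0 z = 0" for z
    using up[of z 0 0] up[of "- z" 0 0] that by (force simp: G_odd)
  obtain \<delta> where \<delta>: "\<delta> > 0"
    and line: "\<And>t. \<exists>s\<in>{t<..t+1}. \<forall>y\<in>{-C..C}. norm (G 0 0 (Complex s y)) \<ge> \<delta>"
    using vertical_line_lower_bound[of C] by metis
  define K where "K = \<bar>A * a\<bar> * exp (a * C) + \<bar>B * b\<bar> * exp (\<bar>b\<bar> * C)"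
  \<comment> \<open>The left side is fixed independently of \<open>r\<close>, strictly to the right
    of the zero at the origin. Zeros with \<open>0 < Re z \<le> s0\<close> are absorbed into
    \<open>L\<close>.\<close>
  obtain s0 where s0: "0 < s0" "s0 \<le> 1" "\<forall>y\<in>{-C..C}. norm (G 0 0 (Complex s0 y)) \<ge> \<delta>"
    using line[of 0] by auto
  define D where "D = 2 * C * (K / \<delta>)"
  have rect: "\<bar>pi * count (box (Complex s0 (-C)) (Complex s C)) - a * (s - s0)\<bar> \<le> \<epsilon> * (s - s0) + D"
    if "s0 < s" "\<forall>y\<in>{-C..C}. norm (G 0 0 (Complex s y)) \<ge> \<delta>" for s
    unfolding D_def using that s0(3) up norm_G'_le[of _ C 0 0]
    by (intro count_rectangle C \<delta>) (auto simp: K_def)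
  define L where "L = cbox (Complex 0 (-C)) (Complex s0 C)"
  \<comment> \<open>Collects every term of the upper and the lower estimate that does not depend on
    \<open>r\<close>.\<close>
  define K' where "K' = a * (C + 2) + a + \<epsilon> + D + pi * count L"
  have D: "D \<ge> 0"
    using C \<delta> by (simp add: D_def K_def)
  \<comment> \<open>The threshold \<open>C + 2\<close> gives
    \<open>s2 > r - C - 1 \<ge> 1 \<ge> s0\<close>, so the inner rectangle is nondegenerate.\<close>
  have "\<bar>pi * count {z. Re z > 0 \<and> norm z \<le> r} - a * r\<bar> \<le> \<epsilon> * r + K'" if r: "r \<ge> C + 2" for r
  proof -
    let ?H = "{z. Re z > 0 \<and> norm z \<le> r}"
    obtain s1 where s1: "r < s1" "s1 \<le> r + 1" "\<forall>y\<in>{-C..C}. norm (G 0 0 (Complex s1 y)) \<ge> \<delta>"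
      using line[of r] by auto
    obtain s2 where s2: "r - C - 1 < s2" "s2 \<le> r - C" "\<forall>y\<in>{-C..C}. norm (G 0 0 (Complex s2 y)) \<ge> \<delta>"
      using line[of "r - C - 1"] by auto
    have "count ?H \<le> count (L \<union> box (Complex s0 (-C)) (Complex s1 C))"
    proof (rule count_mono)
      show "bounded (L \<union> box (Complex s0 (- C)) (Complex s1 C))"
        by (simp add: L_def bounded_box)
      fix z assume z: "z \<in> ?H" "G 0 0 z = 0"
      then have "Re z < s1"
        using s1(1) complex_Re_le_cmod[of z] by simp
      with z strip[OF z(2)] show "z \<in> L \<union> box (Complex s0 (- C)) (Complex s1 C)"
        by (auto simp: L_def in_box_complex_iff in_cbox_complex_iff)
    qed
    also have "\<dots> \<le> count L + count (box (Complex s0 (-C)) (Complex s1 C))"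
      by (rule count_Un_le) (auto simp: L_def bounded_box)
    finally have "pi * count ?H \<le> pi * (count L + count (box (Complex s0 (-C)) (Complex s1 C)))"
      by simp
    also have "\<dots> \<le> pi * count L + (a * (s1 - s0) + \<epsilon> * (s1 - s0) + D)"
      using rect[of s1] s1 r s0 C by (simp add: abs_le_iff algebra_simps)
    also have "\<dots> \<le> pi * count L + (a * (r + 1) + \<epsilon> * (r + 1) + D)"
      using s1 s0 a_pos \<epsilon> by (intro add_mono mult_left_mono) auto
    finally have upper: "pi * count ?H \<le> pi * count L + (a * (r + 1) + \<epsilon> * (r + 1) + D)" .
    have "a * (r - C - 2) - \<epsilon> * r - D \<le> a * (s2 - s0) - \<epsilon> * (s2 - s0) - D"
      using s2 s0 a_pos \<epsilon> C by (intro diff_right_mono diff_mono[OF mult_left_mono mult_left_mono]) linarith+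
    also have "\<dots> \<le> pi * count (box (Complex s0 (-C)) (Complex s2 C))"
      using rect[of s2] s2 r s0 C by (simp add: abs_le_iff algebra_simps)
    also have "\<dots> \<le> pi * count ?H"
    proof (intro mult_left_mono count_mono)
      show "bounded ?H"
        by (rule bounded_subset[OF bounded_cball[of 0 r]]) auto
      fix z assume z: "z \<in> box (Complex s0 (- C)) (Complex s2 C)"
      \<comment> \<open>Here
        \<open>\<bar>Re z\<bar> + \<bar>Im z\<bar> < s2 + C \<le> r\<close>.\<close>
      then have "norm z \<le> r"
        using s2 s0 cmod_le[of z] by (auto simp: in_box_complex_iff)
      with z s0 show "z \<in> ?H" by (auto simp: in_box_complex_iff)
    qed auto
    finally have lower: "a * (r - C - 2) - \<epsilon> * r - D \<le> pi * count ?H" .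
    have "a * (C + 2) \<ge> 0" "pi * count L \<ge> 0"
      using a_pos C count_nonneg by auto
    with upper lower D a_pos \<epsilon> show ?thesis
      unfolding K'_def by (simp add: abs_le_iff algebra_simps)
  qed
  then have "\<forall>\<^sub>F r in at_top. \<bar>pi * count {z. Re z > 0 \<and> norm z \<le> r} - a * r\<bar> \<le> \<epsilon> * r + K'"
    by (auto simp: eventually_at_top_linorder)
  then show ?thesis by (rule that)
qed

lemma count_half_disc_asymptotics:
  "(\<lambda>r. count {z. Re z > 0 \<and> norm z \<le> r} - a * r / pi) \<in> o[at_top](\<lambda>r. r)"
proof (rule landau_o.smallI)
  fix c :: real assume c: "c > 0"
  \<comment> \<open>Half of the allowed error \<open>c * pi * r\<close> goes to \<epsilon>; the
    other half absorbs \<open>K\<close> once \<open>r\<close> is large.\<close>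
  obtain K where "\<forall>\<^sub>F r in at_top. \<bar>pi * count {z. Re z > 0 \<and> norm z \<le> r} - a * r\<bar> \<le> (c * pi / 2) * r + K"
    using count_half_disc[of "c * pi / 2"] c by auto
  moreover have "\<forall>\<^sub>F r in at_top. r \<ge> max 0 (K / (c * pi / 2))"
    by (rule eventually_ge_at_top)
  ultimately show "\<forall>\<^sub>F r in at_top. norm (count {z. Re z > 0 \<and> norm z \<le> r} - a * r / pi) \<le> c * norm r"
  proof eventually_elim
    case (elim r)
    have "K \<le> (c * pi / 2) * r"
      using elim(2) c by (simp add: pos_divide_le_eq mult.commute)
    with elim(1) have "\<bar>pi * (count {z. Re z > 0 \<and> norm z \<le> r} - a * r / pi)\<bar> \<le> pi * (c * r)"
      by (simp add: right_diff_distrib mult.left_commute[of pi] mult.assoc)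
    then show ?case
      using elim(2) by (simp add: abs_mult)
  qed
qed

end

section \<open>Specialisation to \<open>ITE_F\<close>\<close>

theorem theorem4:
  fixes \<gamma> :: real
  assumes "\<gamma> > 0" and "\<gamma> \<noteq> 1"
  shows "(\<forall>z. is_ITE \<gamma> z \<longrightarrow> is_ITE \<gamma> (cnj z))
    \<and> (\<exists>C>0. \<forall>z. is_ITE \<gamma> z \<longrightarrow> \<bar>Im z\<bar> \<le> C)
    \<and> (\<lambda>r. N_alg \<gamma> r - (1 + \<gamma>) * r / pi) \<in> o[at_top](\<lambda>r. r)"
proof -
  \<comment> \<open>Coefficients from the product-to-sum formulas.
    \<open>\<gamma> \<noteq> 1\<close> gives \<open>A \<noteq> 0\<close>, and
    \<open>\<gamma> > 0\<close> gives
    \<open>\<bar>1 - \<gamma>\<bar> < 1 + \<gamma>\<close>.\<close>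
  interpret sine_pair "(\<gamma> - 1) / 2" "(\<gamma> + 1) / 2" "1 + \<gamma>" "1 - \<gamma>"
    by unfold_locales (use assms in auto)
  have F: "ITE_F \<gamma> = G 0 0"
  proof
    fix z :: complex
    have "G 0 0 z = of_real ((\<gamma> - 1) / 2) * sin (z + of_real \<gamma> * z) + of_real ((\<gamma> + 1) / 2) * sin (z - of_real \<gamma> * z)"
      unfolding G_def by (simp add: algebra_simps)
    also have "\<dots> = ITE_F \<gamma> z"
      by (simp add: ITE_F_def sin_add sin_diff field_simps)
    finally show "ITE_F \<gamma> z = G 0 0 z" by simp
  qed
  have "ITE_F \<gamma> (cnj z) = cnj (ITE_F \<gamma> z)" for z
    by (simp add: ITE_F_def cnj_sin cnj_cos)
  then have "\<forall>z. is_ITE \<gamma> z \<longrightarrow> is_ITE \<gamma> (cnj z)"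
    by (simp add: is_ITE_def)
  moreover have "\<exists>C>0. \<forall>z. is_ITE \<gamma> z \<longrightarrow> \<bar>Im z\<bar> \<le> C"
    using zeros_in_strip unfolding is_ITE_def F by metis
  \<comment> \<open>Both sums range over the same zeros, since \<open>Re z > 0\<close> forces
    \<open>z \<noteq> 0\<close>.\<close>
  moreover have "N_alg \<gamma> = (\<lambda>r. count {z. Re z > 0 \<and> norm z \<le> r})"
    unfolding N_alg_def count_def alg_mult_def is_ITE_def F
    by (intro ext arg_cong[of _ _ real] sum.cong) auto
  ultimately show ?thesis
    using count_half_disc_asymptotics by simp
qed

end
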